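(* Let $a,c\in\mathbb{N}_0$ with $c\ge 3$, and $\mathbf{s}=(\{2\}^a,c)$. Then for every positive integer $n$, $$H_n^\star[\mathbf{s}]=-\sum_{(\mathbf{p};\tilde{\mathbf{p}};\tilde{\tilde{\mathbf{p}}})\in\{\overline{2a+2}\circ 1^{\circ(c-2)};\ (a+1)\circ 0^{\circ(c-2)};\ 1\circ\theta^{\circ(c-2)}\}}\mathcal{H}_n[\mathbf{p};\tilde{\mathbf{p}};\tilde{\tilde{\mathbf{p}}}].$$
   Context: Fix $0<q<1$. $[k]=(1-q^k)/(1-q)$; $(x;q)_n=\prod_{i=0}^{n-1}(1-xq^i)$; $\binom{n}{k}_q=(q;q)_n/((q;q)_k(q;q)_{n-k})$ for $0\le k\le n$, else $0$. $\{x\}^a$ denotes $a$ copies of $x$. Signed numbers: $\mathbb{D}_0=\mathbb{N}_0\cup\{\bar k:k\in\mathbb{N}_0\}$ ($\bar k$ a formal symbol), $|k|=|\bar k|=k$, $\operatorname{sgn}(k)=1$, $\operatorname{sgn}(\bar k)=-1$; $a\oplus b=\overline{|a|+|b|}$ if exactly one of $a,b$ is unbarred, $a+b$ if both unbarred, $|a|+|b|$ if both barred. For $\mathbf{s}\in\mathbb{D}_0^m$: $H_n^\star[\mathbf{s}]=\sum_{n\ge k_1\ge\cdots\ge k_m\ge1}\prod_{j}\operatorname{sgn}(s_j)^{k_j}q^{k_j}/[k_j]^{|s_j|}$. $\theta$ is a formal symbol; $Q(r,k)=rk(k-1)/2$ if $r\in\mathbb{Z},r>0$; $Q(r,k)=rk(k-1)/2-k$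 if $r\in\mathbb{Z},r\le0$; $Q(\theta,k)=0$. On $\mathbb{Z}\cup\{\theta\}$: $\theta\boxplus a=a\boxplus\theta=a$; $a\boxplus b=a+b$ for integers with $(a,b)\neq(1,-1),(-1,1)$; $1\boxplus(-1)=\theta$, $(-1)\boxplus1=0$; iterated $\boxplus$ evaluated left to right. For $\mathbf{s}\in\mathbb{D}_0^m$, $\mathbf{t}\in\mathbb{N}_0^m$, $\mathbf{r}\in(\mathbb{Z}\cup\{\theta\})^m$, $m\ge1$: $$\mathcal{H}_n[\mathbf{s};\mathbf{t};\mathbf{r}]=\sum_{n\ge k_1>\cdots>k_m\ge1}\frac{\binom{n}{k_1}_q}{\binom{n+k_1}{k_1}_q}\prod_{j=1}^m\frac{\operatorname{sgn}(s_j)^{k_j}q^{t_jk_j+Q(r_j,k_j)}(1+q^{k_j})}{[k_j]^{|s_j|}}.$$ Merging notation: the sum over $\{\lambda_1\circ\cdots\circ\lambda_N;\mu_1\circ\cdots\circ\mu_N;\nu_1\circ\cdots\circ\nu_N\}$ runs over all $2^{N-1}$ choices, for each of the $N-1$ gaps, of a comma or a merge (same choice in all three strings); each maximal run of merged entries becomes one entry: its $\oplus$-sum in the first string, ordinary sum in the second, $\boxplus$-combination in the third. $x^{\circ k}$ means $k$ copies of $x$ separated by $\circ$. *)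

theory Defs
  imports Complex_Main
begin

definition q_num :: "real \<Rightarrow> nat \<Rightarrow> real" where
  "q_num q k = (1 - q ^ k) / (1 - q)"

definition q_poch :: "real \<Rightarrow> real \<Rightarrow> nat \<Rightarrow> real" where
  "q_poch q x n = (\<Prod>i<n. 1 - x * q ^ i)"

definition q_binom :: "real \<Rightarrow> nat \<Rightarrow> nat \<Rightarrow> real" where
  "q_binom q n k =
     (if k \<le> n then q_poch q q n / (q_poch q q k * q_poch q q (n - k)) else 0)"

text \<open>Signed numbers \<open>\<D>\<^sub>0\<close>: \<open>Plain k\<close> is \<open>k\<close> and \<open>Bar k\<close> is the formal symbol written
  as \<open>k\<close> with an overline. In particular \<open>Bar 0\<close> and \<open>Plain 0\<close> are distinct.\<close>

datatype snum = Plain nat | Bar nat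

fun s_abs :: "snum \<Rightarrow> nat" where
  "s_abs (Plain k) = k"
| "s_abs (Bar k) = k"

fun s_sgn :: "snum \<Rightarrow> real" where
  "s_sgn (Plain k) = 1"
| "s_sgn (Bar k) = - 1"

fun s_oplus :: "snum \<Rightarrow> snum \<Rightarrow> snum" where
  "s_oplus (Plain a) (Plain b) = Plain (a + b)"
| "s_oplus (Plain a) (Bar b) = Bar (a + b)"
| "s_oplus (Bar a) (Plain b) = Bar (a + b)"
| "s_oplus (Bar a) (Bar b) = Plain (a + b)"

text \<open>The set \<open>\<int> \<union> {\<theta>}\<close>.\<close>

datatype tint = TInt int | Theta

fun t_boxplus :: "tint \<Rightarrow> tint \<Rightarrow> tint" where
  "t_boxplus Theta b = b"
| "t_boxplus (TInt a) Theta = TInt a"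
| "t_boxplus (TInt a) (TInt b) =
     (if a = 1 \<and> b = - 1 then Theta
      else if a = - 1 \<and> b = 1 then TInt 0
      else TInt (a + b))"

text \<open>The integer division by 2 is exact, because \<open>k * (k - 1)\<close> is even.\<close>

fun Q_exp :: "tint \<Rightarrow> nat \<Rightarrow> int" where
  "Q_exp Theta k = 0"
| "Q_exp (TInt r) k =
     (if r > 0 then r * int k * (int k - 1) div 2
      else r * int k * (int k - 1) div 2 - int k)"

text \<open>A summation multi-index \<open>(k\<^sub>1, \<dots>, k\<^sub>m)\<close> is a list of length \<open>m\<close>; position \<open>j\<close> of the
  list holds the paper's index \<open>k\<^bsub>j+1\<^esub>\<close>.\<close>

definition weak_decr :: "nat \<Rightarrow> nat \<Rightarrow> nat list set" where
  "weak_decr n m = {ks. length ks = m \<and> set ks \<subseteq> {1..n} \<and> sorted_wrt (\<ge>) ks}"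

definition strict_decr :: "nat \<Rightarrow> nat \<Rightarrow> nat list set" where
  "strict_decr n m = {ks. length ks = m \<and> set ks \<subseteq> {1..n} \<and> sorted_wrt (>) ks}"

lemma finite_weak_decr: "finite (weak_decr n m)"
  by (rule finite_subset[OF _ finite_lists_length_eq[of "{1..n}" m]])
     (auto simp: weak_decr_def)

lemma finite_strict_decr: "finite (strict_decr n m)"
  by (rule finite_subset[OF _ finite_lists_length_eq[of "{1..n}" m]])
     (auto simp: strict_decr_def)

definition H_star :: "real \<Rightarrow> nat \<Rightarrow> snum list \<Rightarrow> real" where
  "H_star q n s =
     (\<Sum>ks \<in> weak_decr n (length s). \<Prod>j<length s.
        s_sgn (s ! j) ^ (ks ! j) * q ^ (ks ! j) / q_num q (ks ! j) ^ s_abs (s ! j))"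

text \<open>Meant for nonempty lists \<open>s\<close>, \<open>t\<close>, \<open>r\<close> of equal length. The exponent of \<open>q\<close> may be
  negative, hence \<open>powi\<close>.\<close>

definition H_cal :: "real \<Rightarrow> nat \<Rightarrow> snum list \<Rightarrow> nat list \<Rightarrow> tint list \<Rightarrow> real" where
  "H_cal q n s t r =
     (\<Sum>ks \<in> strict_decr n (length s).
        q_binom q n (hd ks) / q_binom q (n + hd ks) (hd ks) *
        (\<Prod>j<length s.
           s_sgn (s ! j) ^ (ks ! j)
           * q powi (int (t ! j) * int (ks ! j) + Q_exp (r ! j) (ks ! j))
           * (1 + q ^ (ks ! j))
           / q_num q (ks ! j) ^ s_abs (s ! j)))"

text \<open>\<open>merge f bs xs\<close>, where \<open>bs\<close> has one entry per gap of \<open>xs\<close> (\<open>True\<close> a merge, \<open>False\<close> a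
  comma), replaces each maximal run of merged entries by its \<open>f\<close>-combination, evaluated from
  left to right.\<close>

fun merge :: "('a \<Rightarrow> 'a \<Rightarrow> 'a) \<Rightarrow> bool list \<Rightarrow> 'a list \<Rightarrow> 'a list" where
  "merge f (True # bs) (x # y # xs) = merge f bs (f x y # xs)"
| "merge f (False # bs) (x # y # xs) = x # merge f bs (y # xs)"
| "merge f bs xs = xs"

text \<open>Sum of \<open>F\<close> over the \<open>2 ^ (N - 1)\<close> simultaneous merge/comma choices in three strings of
  common length \<open>N\<close>.\<close>

definition circ_sum ::
  "(snum list \<Rightarrow> nat list \<Rightarrow> tint list \<Rightarrow> real) \<Rightarrow>
   snum list \<Rightarrow> nat list \<Rightarrow> tint list \<Rightarrow> real" where
  "circ_sum F ls ms ns =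
     (\<Sum>bs | length bs = length ls - 1.
        F (merge s_oplus bs ls) (merge (+) bs ms) (merge t_boxplus bs ns))"

end

theory Submission
  imports Defs
begin

text \<open>
  Write \<open>b n k\<close> for the ratio of \<open>q\<close>-binomials in \<open>H_cal\<close>. Splitting off the largest
  summation index turns the merged sum into
  \<open>\<Sum>k. b n k * (-1)^k q^((a+1)k + k(k-1)/2) (1+q^k) / [k]^(2a+2) * tail_sum q (c-2) k\<close>,
  where \<open>tail_sum\<close> collects the contribution of the entries \<open>1\<close>.
  Since \<open>b n k - b (n-1) k = b n k * q^(n-k) [k]^2 / [n]^2\<close>, its difference in \<open>n\<close> is
  \<open>q^n / [n]^2\<close> times the same sum with \<open>a\<close> lowered by one, which is the recursion of \<open>H_star\<close>.
  This reduces everything to \<open>a = -1\<close>, where the sum equals \<open>- 1 / [n]^(c-2)\<close>: the weights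
  telescope, and summation by parts lowers \<open>c\<close> by one at the cost of a factor \<open>1 / [n]\<close>.
\<close>

section \<open>Sums over decreasing multi-indices\<close>

lemma strict_decr_0: "strict_decr n 0 = {[]}"
  by (auto simp: strict_decr_def)

lemma weak_decr_0: "weak_decr n 0 = {[]}"
  by (auto simp: weak_decr_def)

lemma sum_strict_decr_Suc:
  "(\<Sum>ks\<in>strict_decr n (Suc m). f ks) =
   (\<Sum>k=1..n. \<Sum>ks\<in>strict_decr (k - 1) m. f (k # ks))"
proof -
  have "(\<Sum>k=1..n. \<Sum>ks\<in>strict_decr (k - 1) m. f (k # ks)) =
      (\<Sum>(k, ks)\<in>(SIGMA k:{1..n}. strict_decr (k - 1) m). f (k # ks))"
    by (rule sum.Sigma) (auto simp: finite_strict_decr)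
  also have "\<dots> = (\<Sum>ks\<in>strict_decr n (Suc m). f ks)"
    by (rule sum.reindex_bij_witness[where i = "\<lambda>ks. (hd ks, tl ks)" and j = "\<lambda>(k, ks). k # ks"])
      (fastforce simp: strict_decr_def length_Suc_conv)+
  finally show ?thesis ..
qed

lemma sum_weak_decr_Suc:
  "(\<Sum>ks\<in>weak_decr n (Suc m). f ks) =
   (\<Sum>k=1..n. \<Sum>ks\<in>weak_decr k m. f (k # ks))"
proof -
  have "(\<Sum>k=1..n. \<Sum>ks\<in>weak_decr k m. f (k # ks)) =
      (\<Sum>(k, ks)\<in>(SIGMA k:{1..n}. weak_decr k m). f (k # ks))"
    by (rule sum.Sigma) (auto simp: finite_weak_decr)
  also have "\<dots> = (\<Sum>ks\<in>weak_decr n (Suc m). f ks)"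
    by (rule sum.reindex_bij_witness[where i = "\<lambda>ks. (hd ks, tl ks)" and j = "\<lambda>(k, ks). k # ks"])
      (fastforce simp: weak_decr_def length_Suc_conv)+
  finally show ?thesis ..
qed

lemma H_star_Nil: "H_star q n [] = 1"
  by (simp add: H_star_def weak_decr_0)

lemma H_star_Cons:
  "H_star q n (s # ss) =
   (\<Sum>k=1..n. s_sgn s ^ k * q ^ k / q_num q k ^ s_abs s * H_star q k ss)"
  by (simp add: H_star_def sum_weak_decr_Suc prod.lessThan_Suc_shift sum_distrib_left
      del: prod.lessThan_Suc)

section \<open>The merged sum as a single sum\<close>

definition entry_weight :: "real \<Rightarrow> snum \<Rightarrow> nat \<Rightarrow> tint \<Rightarrow> nat \<Rightarrow> real" where
  "entry_weight q s t r k =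
     s_sgn s ^ k * q powi (int t * int k + Q_exp r k) * (1 + q ^ k) / q_num q k ^ s_abs s"

text \<open>\<open>H_cal\<close> with an arbitrary function of the largest index in place of the ratio of
  \<open>q\<close>-binomials; the inner sums of \<open>H_cal\<close> are the case \<open>f = (\<lambda>_. 1)\<close>.\<close>

definition H_head ::
  "(nat \<Rightarrow> real) \<Rightarrow> real \<Rightarrow> nat \<Rightarrow> snum list \<Rightarrow> nat list \<Rightarrow> tint list \<Rightarrow> real" where
  "H_head f q n s t r =
     (\<Sum>ks \<in> strict_decr n (length s).
        f (hd ks) * (\<Prod>j<length s. entry_weight q (s ! j) (t ! j) (r ! j) (ks ! j)))"

lemma H_cal_eq_H_head:
  "H_cal q n = H_head (\<lambda>k. q_binom q n k / q_binom q (n + k) k) q n"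
  by (intro ext) (simp add: H_cal_def H_head_def entry_weight_def)

lemma H_head_Cons:
  "H_head f q n (s # ss) (t # ts) (r # rs) =
   (\<Sum>k=1..n. f k * entry_weight q s t r k * H_head (\<lambda>_. 1) q (k - 1) ss ts rs)"
  by (simp add: H_head_def sum_strict_decr_Suc prod.lessThan_Suc_shift sum_distrib_left
      mult.assoc del: prod.lessThan_Suc)

lemma H_head_Nil: "H_head (\<lambda>_. 1) q n [] t r = 1"
  by (simp add: H_head_def strict_decr_0)

lemma circ_sum_singleton: "circ_sum F [s] [t] [r] = F [s] [t] [r]"
  by (simp add: circ_sum_def)

lemma sum_bool_lists_Suc:
  "(\<Sum>bs | length bs = Suc m. f bs) =
   (\<Sum>bs | length bs = m. f (True # bs)) + (\<Sum>bs | length bs = m. f (False # bs))"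
proof -
  have fin: "finite {bs :: bool list. length bs = m}"
    using finite_lists_length_eq[of "UNIV :: bool set" m] by simp
  have eq: "{bs :: bool list. length bs = Suc m} =
      (#) True ` {bs. length bs = m} \<union> (#) False ` {bs. length bs = m}"
  proof (intro equalityI subsetI)
    fix bs :: "bool list" assume "bs \<in> {bs. length bs = Suc m}"
    then obtain b bs' where "bs = b # bs'" "length bs' = m"
      by (auto simp: length_Suc_conv)
    then show "bs \<in> (#) True ` {bs. length bs = m} \<union> (#) False ` {bs. length bs = m}"
      by (cases b) auto
  qed auto
  have "(\<Sum>bs | length bs = Suc m. f bs) =
      sum f ((#) True ` {bs. length bs = m}) + sum f ((#) False ` {bs. length bs = m})"
    unfolding eq using fin by (intro sum.union_disjoint) auto
  then show ?thesis
    by (simp add: sum.reindex)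
qed

text \<open>Only the first gap is resolved. As merging runs from left to right, a merged pair is
  again a single head entry, while a comma fixes the head inside \<open>F\<close>.\<close>

lemma circ_sum_Cons_Cons:
  "circ_sum F (s # s' # ss) (t # t' # ts) (r # r' # rs) =
   circ_sum F (s_oplus s s' # ss) ((t + t') # ts) (t_boxplus r r' # rs) +
   circ_sum (\<lambda>ss ts rs. F (s # ss) (t # ts) (r # rs)) (s' # ss) (t' # ts) (r' # rs)"
  by (simp add: circ_sum_def sum_bool_lists_Suc)

text \<open>Contribution of \<open>m\<close> entries 1 behind an entry with index \<open>k\<close>.
  The first of them either merges, giving 1/[k] without a new factor 1 + q^k, or opens a smaller
  index \<open>j\<close>.\<close>

fun tail_sum :: "real \<Rightarrow> nat \<Rightarrow> nat \<Rightarrow> real" where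
  "tail_sum q 0 k = 1"
| "tail_sum q (Suc m) k =
     tail_sum q m k / q_num q k + (\<Sum>j\<in>{1..<k}. (1 + q ^ j) * (tail_sum q m j / q_num q j))"

lemma t_boxplus_Theta_right: "t_boxplus r Theta = r"
  by (cases r) auto

lemma entry_weight_oplus_one:
  "entry_weight q (s_oplus s (Plain 1)) t r k = entry_weight q s t r k / q_num q k"
  by (cases s) (simp_all add: entry_weight_def)

lemma entry_weight_one:
  "entry_weight q (Plain 1) 0 Theta k = (1 + q ^ k) / q_num q k"
  by (simp add: entry_weight_def)

lemma circ_sum_sum:
  "circ_sum (\<lambda>ss ts rs. \<Sum>k\<in>K. g k * F k ss ts rs) s t r = (\<Sum>k\<in>K. g k * circ_sum (F k) s t r)"
  unfolding circ_sum_def by (subst sum.swap) (simp add: sum_distrib_left)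

text \<open>Induction on \<open>m\<close> through the first gap: a merge alters \<open>s\<close>, a
  comma leads to \<open>f\<close> = 1 and cutoff k - 1, hence the generalisation. Since 0 and
  \<open>Theta\<close> are neutral, \<open>t\<close> and \<open>r\<close> survive every merge and
  the exceptional cases of \<open>t_boxplus\<close> never arise.\<close>

lemma circ_sum_H_head:
  "circ_sum (H_head f q n) (s # replicate m (Plain 1)) (t # replicate m 0) (r # replicate m Theta) =
   (\<Sum>k=1..n. f k * entry_weight q s t r k * tail_sum q m k)"
proof (induction m arbitrary: f n s t r)
  case 0
  then show ?case
    by (simp add: circ_sum_singleton H_head_Cons H_head_Nil)
next
  case (Suc m)
  have inner: "circ_sum (H_head (\<lambda>_. 1) q (k - 1))
        (Plain 1 # replicate m (Plain 1)) (0 # replicate m 0) (Theta # replicate m Theta) =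
      (\<Sum>j\<in>{1..<k}. (1 + q ^ j) * (tail_sum q m j / q_num q j))" for k
  proof -
    have "{1..k - 1} = {1..<k}" by auto
    then show ?thesis
      unfolding Suc.IH entry_weight_one by simp
  qed
  have "circ_sum (H_head f q n) (s # replicate (Suc m) (Plain 1)) (t # replicate (Suc m) 0)
        (r # replicate (Suc m) Theta) =
      (\<Sum>k=1..n. f k * entry_weight q (s_oplus s (Plain 1)) t r k * tail_sum q m k) +
      (\<Sum>k=1..n. f k * entry_weight q s t r k *
        (\<Sum>j\<in>{1..<k}. (1 + q ^ j) * (tail_sum q m j / q_num q j)))"
    by (simp only: replicate_Suc circ_sum_Cons_Cons t_boxplus_Theta_right add_0_right Suc.IH
        H_head_Cons circ_sum_sum inner[unfolded Suc.IH])
  also have "\<dots> = (\<Sum>k=1..n. f k * entry_weight q s t r k * tail_sum q (Suc m) k)"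
    by (simp only: entry_weight_oplus_one tail_sum.simps sum.distrib[symmetric])
      (simp add: algebra_simps)
  finally show ?case .
qed

section \<open>The ratio of q-binomials\<close>

definition binom_ratio :: "real \<Rightarrow> nat \<Rightarrow> nat \<Rightarrow> real" where
  "binom_ratio q n k = q_binom q n k / q_binom q (n + k) k"

lemma binom_ratio_eq_0: "n < k \<Longrightarrow> binom_ratio q n k = 0"
  by (simp add: binom_ratio_def q_binom_def)

lemma triangular_Suc: "Suc k * (Suc k - 1) div 2 = k * (k - 1) div 2 + k"
  using div_mult_self2[of 2 "k * (k - 1)" k] by (cases k) (simp_all add: algebra_simps)

context
  fixes q :: real
  assumes q_pos: "0 < q" and q_less_1: "q < 1"
begin

lemma one_minus_power_pos: "0 < k \<Longrightarrow> 0 < 1 - q ^ k"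
  using q_pos q_less_1 by (simp add: power_less_one_iff)

lemma q_num_pos: "0 < k \<Longrightarrow> 0 < q_num q k"
  using one_minus_power_pos q_less_1 by (simp add: q_num_def)

lemma q_poch_Suc: "q_poch q q (Suc n) = q_poch q q n * (1 - q ^ Suc n)"
  by (simp add: q_poch_def)

lemma q_poch_pos: "0 < q_poch q q n"
  by (induction n) (simp add: q_poch_def, simp only: q_poch_Suc one_minus_power_pos
      mult_pos_pos zero_less_Suc)

lemma binom_ratio_eq:
  "k \<le> n \<Longrightarrow> binom_ratio q n k = (q_poch q q n)\<^sup>2 / (q_poch q q (n - k) * q_poch q q (n + k))"
  using q_poch_pos[of n] q_poch_pos[of k]
  by (simp add: binom_ratio_def q_binom_def power2_eq_square field_simps)

lemma binom_ratio_0: "binom_ratio q n 0 = 1"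
  using q_poch_pos[of n] by (simp add: binom_ratio_eq power2_eq_square)

lemma binom_ratio_Suc_right:
  assumes "k \<le> n"
  shows "binom_ratio q n (Suc k) * (1 - q ^ (n + Suc k)) = binom_ratio q n k * (1 - q ^ (n - k))"
proof (cases "k = n")
  case True
  then show ?thesis by (simp add: binom_ratio_eq_0)
next
  case False
  with assms obtain d where n: "n = Suc (k + d)"
    using less_imp_Suc_add by (metis le_neq_implies_less)
  have d: "n - k = Suc d" "n - Suc k = d" "n + Suc k = Suc (n + k)"
    using n by simp_all
  have "0 < 1 - q ^ Suc d" "0 < 1 - q ^ Suc (n + k)"
    by (rule one_minus_power_pos, simp)+
  moreover have "binom_ratio q n k =
      (q_poch q q n)\<^sup>2 / ((q_poch q q d * (1 - q ^ Suc d)) * q_poch q q (n + k))"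
    using assms by (simp only: binom_ratio_eq d q_poch_Suc)
  moreover have "binom_ratio q n (Suc k) =
      (q_poch q q n)\<^sup>2 / (q_poch q q d * (q_poch q q (n + k) * (1 - q ^ Suc (n + k))))"
    by (subst binom_ratio_eq) (simp add: n, simp only: d q_poch_Suc)
  ultimately show ?thesis
    unfolding d using q_poch_pos[of d] q_poch_pos[of "n + k"]
    by (simp only:) (simp add: divide_simps)
qed

text \<open>Stated without division so that k = n + 1 is included, where both sides vanish.\<close>

lemma binom_ratio_Suc_left:
  assumes "k \<le> Suc n"
  shows "binom_ratio q (Suc n) k * ((1 - q ^ (Suc n - k)) * (1 - q ^ (Suc n + k))) =
    binom_ratio q n k * (1 - q ^ Suc n)\<^sup>2"
proof (cases "k = Suc n")
  case True
  then show ?thesis by (simp add: binom_ratio_eq_0)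
next
  case False
  with assms have k: "k \<le> n" by simp
  have d: "Suc n - k = Suc (n - k)" "Suc n + k = Suc (n + k)"
    using k by simp_all
  have "0 < 1 - q ^ Suc (n - k)" "0 < 1 - q ^ Suc (n + k)"
    by (rule one_minus_power_pos, simp)+
  moreover have "binom_ratio q (Suc n) k = (q_poch q q n * (1 - q ^ Suc n))\<^sup>2 /
      ((q_poch q q (n - k) * (1 - q ^ Suc (n - k))) *
       (q_poch q q (n + k) * (1 - q ^ Suc (n + k))))"
    using assms by (simp only: binom_ratio_eq d q_poch_Suc)
  ultimately show ?thesis
    unfolding d binom_ratio_eq[OF k] using q_poch_pos[of "n - k"] q_poch_pos[of "n + k"]
    by (simp add: divide_simps power_mult_distrib mult_ac)
qed

text \<open>With x = q^(n+1-k) and y = q^k this is (1 - xy)^2 - (1 - x)(1 - xy^2) = x (1 -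
  y)^2.\<close>

lemma binom_ratio_diff:
  assumes "k \<le> Suc n"
  shows "binom_ratio q (Suc n) k - binom_ratio q n k =
    binom_ratio q (Suc n) k * q ^ (Suc n - k) * (q_num q k)\<^sup>2 / (q_num q (Suc n))\<^sup>2"
proof -
  define x y where "x = q ^ (Suc n - k)" and "y = q ^ k"
  have N: "q ^ Suc n = x * y" "q ^ (Suc n + k) = x * y * y"
    using assms by (simp_all only: x_def y_def power_add[symmetric]) simp_all
  have pos: "0 < 1 - x * y"
    using one_minus_power_pos[of "Suc n"] N by simp
  have "binom_ratio q n k * (1 - x * y)\<^sup>2 = binom_ratio q (Suc n) k * ((1 - x) * (1 - x * y * y))"
    using binom_ratio_Suc_left[OF assms] by (simp only: N x_def[symmetric])
  then have "(binom_ratio q (Suc n) k - binom_ratio q n k) * (1 - x * y)\<^sup>2 =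
      binom_ratio q (Suc n) k * ((1 - x * y)\<^sup>2 - (1 - x) * (1 - x * y * y))"
    by (simp only: left_diff_distrib[of "binom_ratio q (Suc n) k"]
        right_diff_distrib[of "binom_ratio q (Suc n) k"])
  also have "(1 - x * y)\<^sup>2 - (1 - x) * (1 - x * y * y) = x * (1 - y)\<^sup>2"
    by (simp add: power2_eq_square algebra_simps)
  finally have "binom_ratio q (Suc n) k - binom_ratio q n k =
      binom_ratio q (Suc n) k * x * (1 - y)\<^sup>2 / (1 - x * y)\<^sup>2"
    using pos by (simp add: divide_simps)
  then show ?thesis
    using q_less_1 by (simp only: q_num_def N x_def[symmetric] y_def[symmetric])
      (simp add: power_divide)
qed

section \<open>The single sum\<close>

definition base_weight :: "nat \<Rightarrow> nat \<Rightarrow> real" where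
  "base_weight n k = (-1) ^ k * q ^ (k * (k - 1) div 2) * (1 + q ^ k) * binom_ratio q n k"

text \<open>Closed form, for n > 0 and k \<le> n, of the sum of \<open>base_weight n j\<close> over
  j from \<open>k\<close> to \<open>n\<close>.\<close>

definition antidiff :: "nat \<Rightarrow> nat \<Rightarrow> real" where
  "antidiff n k = (-1) ^ k * q ^ (k * (k - 1) div 2) * binom_ratio q n k * (1 - q ^ (n + k)) / (1 - q ^ n)"

lemma antidiff_Suc:
  assumes "k \<le> n"
  shows "antidiff n (Suc k) =
    - ((-1) ^ k * q ^ (k * (k - 1) div 2) * q ^ k * binom_ratio q n k * (1 - q ^ (n - k)) / (1 - q ^ n))"
  using binom_ratio_Suc_right[OF assms]
  unfolding antidiff_def triangular_Suc power_add[of q _ k] by (simp add: mult.assoc)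

text \<open>After \<open>antidiff_Suc\<close> both terms share every factor of
  \<open>base_weight n k\<close> except 1 + q^k, which the identity in the proof supplies while
  cancelling the denominator 1 - q^n.\<close>

lemma antidiff_diff:
  assumes "0 < n" "k \<le> n"
  shows "antidiff n k - antidiff n (Suc k) = base_weight n k"
proof -
  have e: "q ^ n = q ^ (n - k) * q ^ k" "q ^ (n + k) = q ^ (n - k) * q ^ k * q ^ k"
    using assms by (simp_all only: power_add[symmetric]) simp_all
  have "(1 - q ^ (n + k)) + q ^ k * (1 - q ^ (n - k)) = (1 + q ^ k) * (1 - q ^ n)"
    unfolding e by (simp add: algebra_simps)
  then have "(1 + q ^ k) = ((1 - q ^ (n + k)) + q ^ k * (1 - q ^ (n - k))) / (1 - q ^ n)"
    using one_minus_power_pos[OF assms(1)] by simp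
  then show ?thesis
    unfolding antidiff_Suc[OF assms(2)] unfolding base_weight_def antidiff_def
    by (simp only:) (simp add: algebra_simps add_divide_distrib diff_divide_distrib)
qed

text \<open>Here the terms in q^(n+k) cancel and leave 1 - q^(2k), so 1 - q^n stays in the
  denominator. This is the source of the factor 1/[n] gained for each entry 1.\<close>

lemma antidiff_sum:
  assumes "0 < n" "0 < k" "k \<le> n"
  shows "(antidiff n k + q ^ k * antidiff n (Suc k)) / q_num q k = base_weight n k / q_num q n"
proof -
  have e: "q ^ (n + k) = q ^ (n - k) * q ^ k * q ^ k"
    using assms by (simp only: power_add[symmetric]) simp
  have "(1 - q ^ (n + k)) - q ^ k * (q ^ k * (1 - q ^ (n - k))) = (1 + q ^ k) * (1 - q ^ k)"
    unfolding e by (simp add: algebra_simps)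
  moreover have "antidiff n k + q ^ k * antidiff n (Suc k) =
      (-1) ^ k * q ^ (k * (k - 1) div 2) * binom_ratio q n k *
      ((1 - q ^ (n + k)) - q ^ k * (q ^ k * (1 - q ^ (n - k)))) / (1 - q ^ n)"
    unfolding antidiff_Suc[OF assms(3)] unfolding antidiff_def
    by (simp add: algebra_simps add_divide_distrib diff_divide_distrib)
  ultimately have "antidiff n k + q ^ k * antidiff n (Suc k) =
      base_weight n k * (1 - q ^ k) / (1 - q ^ n)"
    by (simp add: base_weight_def)
  then show ?thesis
    using one_minus_power_pos[OF assms(1)] one_minus_power_pos[OF assms(2)] q_less_1
    by (simp add: q_num_def)
qed

lemma antidiff_1: "0 < n \<Longrightarrow> antidiff n (Suc 0) = - 1"
  using antidiff_Suc[of 0 n] one_minus_power_pos[of n] by (simp add: binom_ratio_0)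

lemma antidiff_beyond: "antidiff n (Suc n) = 0"
  by (simp add: antidiff_def binom_ratio_eq_0)

text \<open>The coefficient of \<open>u k\<close> is its own difference C k - C (k+1) plus 1 + q^k
  times the later differences, which telescope to C (k+1) - C (N+1).\<close>

lemma summation_by_parts_tail:
  fixes C u :: "nat \<Rightarrow> real"
  shows "(\<Sum>k=1..N. (C k - C (Suc k)) * (u k + (\<Sum>j\<in>{1..<k}. (1 + q ^ j) * u j))) =
    (\<Sum>k=1..N. (C k + q ^ k * C (Suc k)) * u k) - C (Suc N) * (\<Sum>j\<in>{1..<Suc N}. (1 + q ^ j) * u j)"
  by (induction N) (simp_all add: algebra_simps)

lemma sum_base_weight_tail_sum:
  assumes "0 < n"
  shows "(\<Sum>k=1..n. base_weight n k * tail_sum q m k) = - 1 / q_num q n ^ m"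
proof (induction m)
  case 0
  have "(\<Sum>k=1..n. base_weight n k) = (\<Sum>k=1..n. antidiff n k - antidiff n (Suc k))"
    using assms by (intro sum.cong) (simp_all add: antidiff_diff)
  also have "\<dots> = antidiff n 1 - antidiff n (Suc n)"
    using sum_Suc_diff[of 1 n "antidiff n"] assms
    by (simp add: sum_subtractf algebra_simps)
  finally show ?case
    using assms by (simp add: antidiff_1 antidiff_beyond)
next
  case (Suc m)
  have "(\<Sum>k=1..n. base_weight n k * tail_sum q (Suc m) k) =
      (\<Sum>k=1..n. (antidiff n k - antidiff n (Suc k)) *
        (tail_sum q m k / q_num q k + (\<Sum>j\<in>{1..<k}. (1 + q ^ j) * (tail_sum q m j / q_num q j))))"
    using assms by (intro sum.cong) (simp_all add: antidiff_diff)
  also have "\<dots> = (\<Sum>k=1..n. (antidiff n k + q ^ k * antidiff n (Suc k)) * (tail_sum q m k / q_num q k))"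
    by (subst summation_by_parts_tail) (simp add: antidiff_beyond)
  also have "\<dots> = (\<Sum>k=1..n. (antidiff n k + q ^ k * antidiff n (Suc k)) / q_num q k * tail_sum q m k)"
    by simp
  also have "\<dots> = (\<Sum>k=1..n. base_weight n k / q_num q n * tail_sum q m k)"
    using assms by (intro sum.cong refl arg_cong2[where f = "(*)"] antidiff_sum) auto
  also have "\<dots> = (\<Sum>k=1..n. base_weight n k * tail_sum q m k) / q_num q n"
    by (simp add: sum_divide_distrib)
  finally show ?case
    unfolding Suc.IH by simp
qed

section \<open>The recursion in \<open>n\<close> and its match with both sides of the
  theorem\<close>

definition single_sum :: "nat \<Rightarrow> nat \<Rightarrow> nat \<Rightarrow> real" where
  "single_sum m a n =
     - (\<Sum>k=1..n. base_weight n k * (q ^ (a * k) / q_num q k ^ (2 * a)) * tail_sum q m k)"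

text \<open>The second argument of \<open>single_sum\<close> is one more than the number of leading
  2s, so 0 is the case a = -1.\<close>

lemma single_sum_0: "0 < n \<Longrightarrow> single_sum m 0 n = 1 / q_num q n ^ m"
  using sum_base_weight_tail_sum[of n m] by (simp add: single_sum_def)

text \<open>The factor q^(n+1-k) from \<open>binom_ratio_diff\<close> meets the extra q^k to give
  q^(n+1), free of \<open>k\<close>, and [k]^2 cancels two powers in the denominator.\<close>

lemma base_weight_diff:
  assumes "0 < k" "k \<le> Suc n"
  shows "(base_weight (Suc n) k - base_weight n k) * (q ^ (Suc a * k) / q_num q k ^ (2 * Suc a)) =
    q ^ Suc n / (q_num q (Suc n))\<^sup>2 * (base_weight (Suc n) k * (q ^ (a * k) / q_num q k ^ (2 * a)))"
proof -
  define w where "w = (-1) ^ k * q ^ (k * (k - 1) div 2) * (1 + q ^ k)"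
  have bw: "base_weight n k = w * binom_ratio q n k" for n
    by (simp add: base_weight_def w_def)
  have "base_weight (Suc n) k - base_weight n k =
      base_weight (Suc n) k * q ^ (Suc n - k) * (q_num q k)\<^sup>2 / (q_num q (Suc n))\<^sup>2"
    using binom_ratio_diff[OF assms(2)] by (simp add: bw right_diff_distrib[symmetric])
  moreover have "q ^ (Suc a * k) = q ^ k * q ^ (a * k)"
    "q_num q k ^ (2 * Suc a) = (q_num q k)\<^sup>2 * q_num q k ^ (2 * a)"
    by (simp_all add: power_add power2_eq_square)
  moreover have "q ^ Suc n = q ^ (Suc n - k) * q ^ k"
    using assms by (simp only: power_add[symmetric]) simp
  ultimately show ?thesis
    using q_num_pos[OF assms(1)] q_num_pos[of "Suc n"] by (simp only:) (simp add: divide_simps)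
qed

lemma single_sum_Suc_Suc:
  "single_sum m (Suc a) (Suc n) =
   single_sum m (Suc a) n + q ^ Suc n / (q_num q (Suc n))\<^sup>2 * single_sum m a (Suc n)"
proof -
  let ?v = "\<lambda>k. q ^ (Suc a * k) / q_num q k ^ (2 * Suc a)"
  \<comment> \<open>A vanishing term at k = n + 1 gives both sums the same range.\<close>
  have "base_weight n (Suc n) = 0"
    by (simp add: base_weight_def binom_ratio_eq_0)
  then have "single_sum m (Suc a) n = - (\<Sum>k=1..Suc n. base_weight n k * ?v k * tail_sum q m k)"
    by (simp add: single_sum_def)
  then have "single_sum m (Suc a) (Suc n) - single_sum m (Suc a) n =
      - (\<Sum>k=1..Suc n. (base_weight (Suc n) k - base_weight n k) * ?v k * tail_sum q m k)"
    by (simp only: single_sum_def left_diff_distrib sum_subtractf)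
  also have "\<dots> = - (\<Sum>k=1..Suc n. q ^ Suc n / (q_num q (Suc n))\<^sup>2 *
      (base_weight (Suc n) k * (q ^ (a * k) / q_num q k ^ (2 * a))) * tail_sum q m k)"
    by (intro arg_cong[where f = uminus] sum.cong refl arg_cong2[where f = "(*)"] base_weight_diff) auto
  also have "\<dots> = q ^ Suc n / (q_num q (Suc n))\<^sup>2 * single_sum m a (Suc n)"
    by (simp only: single_sum_def sum_distrib_left mult.assoc mult_minus_right)
  finally show ?thesis by simp
qed

lemma single_sum_Suc:
  "single_sum m (Suc a) n = (\<Sum>l=1..n. q ^ l / (q_num q l)\<^sup>2 * single_sum m a l)"
proof (induction n)
  case 0
  then show ?case by (simp add: single_sum_def)
next
  case (Suc n)
  then show ?case by (simp only: single_sum_Suc_Suc) simp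
qed

text \<open>Each leading 2 is one use of \<open>single_sum_Suc\<close>. The last entry m + 2 is one
  more, with [l]^(m+2) split into [l]^2 and the starting value 1/[l]^m.\<close>

lemma H_star_eq_single_sum:
  "H_star q n (replicate a (Plain 2) @ [Plain (m + 2)]) = single_sum m (Suc a) n"
proof (induction a arbitrary: n)
  case 0
  show ?case
    by (simp add: H_star_Cons H_star_Nil single_sum_Suc single_sum_0 power2_eq_square mult.assoc)
next
  case (Suc a)
  then show ?case by (simp add: H_star_Cons single_sum_Suc[of m "Suc a"])
qed

lemma entry_weight_Bar:
  "entry_weight q (Bar (2 * a)) a (TInt 1) k =
   (-1) ^ k * q ^ (k * (k - 1) div 2) * (1 + q ^ k) * (q ^ (a * k) / q_num q k ^ (2 * a))"
proof -
  \<comment> \<open>At k = 0 the natural-number difference truncates, but the factor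
    \<open>k\<close> makes both sides 0.\<close>
  have "int k * (int k - 1) div 2 = int (k * (k - 1) div 2)"
    by (cases k) (simp_all add: zdiv_int algebra_simps)
  then have "int a * int k + Q_exp (TInt 1) k = int (a * k + k * (k - 1) div 2)"
    by simp
  then have "q powi (int a * int k + Q_exp (TInt 1) k) = q ^ (a * k) * q ^ (k * (k - 1) div 2)"
    by (simp only: power_int_of_nat power_add)
  then show ?thesis
    by (simp add: entry_weight_def)
qed

lemma circ_sum_H_cal_eq_single_sum:
  "circ_sum (H_cal q n) (Bar (2 * a) # replicate m (Plain 1)) (a # replicate m 0)
     (TInt 1 # replicate m Theta) = - single_sum m a n"
  unfolding H_cal_eq_H_head circ_sum_H_head entry_weight_Bar single_sum_def base_weight_def
    binom_ratio_def
  by (simp add: mult_ac)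

end

theorem theorem4p1:
  fixes q :: real and a c n :: nat
  assumes "0 < q" and "q < 1" and "c \<ge> 3" and "n \<ge> 1"
  shows "H_star q n (replicate a (Plain 2) @ [Plain c]) =
    - circ_sum (H_cal q n)
        (Bar (2 * a + 2) # replicate (c - 2) (Plain 1))
        ((a + 1) # replicate (c - 2) 0)
        (TInt 1 # replicate (c - 2) Theta)"
proof -
  have "Suc (Suc (c - 2)) = c"
    using assms(3) by simp
  then show ?thesis
    using H_star_eq_single_sum[OF assms(1,2), of n a "c - 2"]
      circ_sum_H_cal_eq_single_sum[OF assms(1,2), of n "Suc a" "c - 2"]
    by simp
qed

end
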